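(* Let $a\ge 3$ be an odd natural number and let $n$ be a positive integer with $n\le 3a^2-16$. If $X\subset\mathbb{S}^{n-1}$ is an equiangular set with scalar products $\frac1a,-\frac1a$ and exactly $\frac{(a^2-2)(a^2-1)}{2}$ points, then $X$ is contained in an $(a^2-2)$-dimensional linear subspace of $\mathbb{R}^n$.
   Context: $\mathbb{S}^{n-1}$ denotes the unit sphere in $\mathbb{R}^n$. For $\alpha\in[0,1)$, an equiangular set in $\mathbb{S}^{n-1}$ with scalar products $\alpha,-\alpha$ is a finite set $X\subset\mathbb{S}^{n-1}$ such that the scalar product of any two distinct points of $X$ belongs to $\{\alpha,-\alpha\}$. *)

theory Defs
  imports "HOL-Analysis.Analysis"
begin

definition equiangular_set :: "real \<Rightarrow> (real ^ 'n) set \<Rightarrow> bool" where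
  "equiangular_set \<alpha> X \<longleftrightarrow>
     0 \<le> \<alpha> \<and> \<alpha> < 1 \<and> finite X \<and> X \<subseteq> sphere 0 1 \<and>
     (\<forall>x\<in>X. \<forall>y\<in>X. x \<noteq> y \<longrightarrow> x \<bullet> y \<in> {\<alpha>, - \<alpha>})"

end

theory Submission
  imports Defs
begin

text \<open>
  Fix \<open>z \<in> X\<close> and, for the other points \<open>y\<close>, put \<open>w\<^sub>y = \<plusminus>a y - z\<close>, with the sign of \<open>z \<bullet> y\<close>.
  These vectors are orthogonal to \<open>z\<close>, have squared norm \<open>a\<^sup>2 - 1\<close>, and their mutual scalar
  products are \<open>\<plusminus>a - 1\<close>. The cubic \<open>t\<^sup>3 - (a\<^sup>2 + 3) t\<close> takes the same value at \<open>\<plusminus>a - 1\<close>, and for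
  the given cardinality its sum over all pairs vanishes. Positive definiteness of the Gegenbauer
  kernel of degree 3 bounds the sum of cubes below by a multiple of \<open>\<bar>v\<bar>\<^sup>2\<close>, where \<open>v\<close> is the sum of
  the \<open>w\<^sub>y\<close>; for \<open>n \<le> 3a\<^sup>2 - 16\<close> this is only possible if \<open>v = 0\<close>. Hence every \<open>z \<in> X\<close> is an
  eigenvector of the frame operator \<open>\<Sum>\<^sub>y y y\<^sup>T\<close> of \<open>X\<close>, always with the same eigenvalue, and taking the
  trace gives the dimension of the span.
\<close>

lemma parseval_orthonormal:
  fixes B :: "'a::euclidean_space set"
  assumes "pairwise orthogonal B" and "\<And>b. b \<in> B \<Longrightarrow> norm b = 1"
    and "x \<in> span B"
  shows "(\<Sum>b\<in>B. (x \<bullet> b) * (y \<bullet> b)) = x \<bullet> y"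
proof -
  have fin: "finite B"
    using assms(1,2) by (metis norm_zero pairwise_orthogonal_independent finiteI_independent zero_neq_one)
  have "(\<Sum>b\<in>B. (b \<bullet> x) *\<^sub>R b) = x"
    using orthonormal_basis_expand[OF assms fin] by (simp add: inner_commute)
  then have "x \<bullet> y = (\<Sum>b\<in>B. (b \<bullet> x) *\<^sub>R b) \<bullet> y" by simp
  then show ?thesis by (simp add: inner_sum_left inner_sum_right inner_commute)
qed

text \<open>By symmetry of \<open>S\<close> the three placements of \<open>v\<close> contribute
  equally, and each contracts \<open>S\<close> to its trace. This computes both the pairing of
  \<open>T\<close> with \<open>D\<close> and the squared norm of \<open>D\<close>, which is
  symmetric itself.\<close>

lemma sum_symmetric_tensor:
  fixes S :: "'b \<Rightarrow> 'b \<Rightarrow> 'b \<Rightarrow> real" and v :: "'b \<Rightarrow> real"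
  assumes "finite B"
    and sym: "\<And>b c d. S b c d = S c b d" "\<And>b c d. S b c d = S b d c"
  shows "(\<Sum>b\<in>B. \<Sum>c\<in>B. \<Sum>d\<in>B. S b c d *
            (v b * of_bool (c = d) + v c * of_bool (b = d) + v d * of_bool (b = c)))
         = 3 * (\<Sum>b\<in>B. v b * (\<Sum>c\<in>B. S b c c))"
proof -
  have 1: "(\<Sum>b\<in>B. \<Sum>c\<in>B. \<Sum>d\<in>B. S b c d * (v b * of_bool (c = d))) = (\<Sum>b\<in>B. v b * (\<Sum>c\<in>B. S b c c))"
    using assms(1) by (simp add: of_bool_def if_distrib sum_distrib_left mult.commute cong: if_cong)
  have 2: "(\<Sum>b\<in>B. \<Sum>c\<in>B. \<Sum>d\<in>B. S b c d * (v c * of_bool (b = d))) = (\<Sum>b\<in>B. v b * (\<Sum>c\<in>B. S b c c))"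
    unfolding 1[symmetric] by (subst sum.swap) (intro sum.cong refl, simp add: sym(1))
  have 3: "(\<Sum>b\<in>B. \<Sum>c\<in>B. \<Sum>d\<in>B. S b c d * (v d * of_bool (b = c))) = (\<Sum>b\<in>B. v b * (\<Sum>c\<in>B. S b c c))"
    unfolding 2[symmetric] by (rule sum.cong[OF refl], subst sum.swap) (intro sum.cong refl, simp add: sym(2))
  show ?thesis
    using 1 2 3 by (simp add: distrib_left sum.distrib)
qed

text \<open>
  This is Cauchy-Schwarz for the tensors \<open>T = \<Sum>\<^sub>i w\<^sub>i \<otimes> w\<^sub>i \<otimes> w\<^sub>i\<close> and \<open>D\<close>, three times the
  symmetrization of \<open>v \<otimes> I\<close>; the part of \<open>T\<close> orthogonal to such \<open>D\<close> is its harmonic part.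
\<close>

lemma sum_inner_cubed_ge:
  fixes w :: "'i \<Rightarrow> 'a::euclidean_space"
  assumes "subspace W" and wW: "\<And>i. i \<in> I \<Longrightarrow> w i \<in> W"
    and norm_w: "\<And>i. i \<in> I \<Longrightarrow> w i \<bullet> w i = r"
  defines "v \<equiv> \<Sum>i\<in>I. w i"
  shows "3 * r\<^sup>2 * (v \<bullet> v) \<le> (real (dim W) + 2) * (\<Sum>i\<in>I. \<Sum>j\<in>I. (w i \<bullet> w j) ^ 3)"
proof -
  obtain B where B: "B \<subseteq> W" "pairwise orthogonal B" "\<And>b. b \<in> B \<Longrightarrow> norm b = 1"
    "independent B" "card B = dim W" "span B = W"
    using orthonormal_basis_subspace[OF assms(1)] by metis
  have fin: "finite B" using B(4) by (rule finiteI_independent)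
  have parseval: "(\<Sum>b\<in>B. (x \<bullet> b) * (y \<bullet> b)) = x \<bullet> y" if "x \<in> W" for x y
    using parseval_orthonormal[OF B(2,3)] that B(6) by simp
  have vW: "v \<in> W" unfolding v_def using assms(1) wW by (intro subspace_sum)
  define m where "m = real (dim W) + 2"
  have m: "m > 0" by (simp add: m_def)
  define T where "T b c d = (\<Sum>i\<in>I. (w i \<bullet> b) * (w i \<bullet> c) * (w i \<bullet> d))" for b c d
  define D where "D b c d = (v \<bullet> b) * of_bool (c = d) + (v \<bullet> c) * of_bool (b = d)
      + (v \<bullet> d) * of_bool (b = c)" for b c d :: 'a
  let ?sum = "\<lambda>f. \<Sum>b\<in>B. \<Sum>c\<in>B. \<Sum>d\<in>B. f b c d :: real"
  have TT: "?sum (\<lambda>b c d. (T b c d)\<^sup>2) = (\<Sum>i\<in>I. \<Sum>j\<in>I. (w i \<bullet> w j) ^ 3)"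
  proof -
    \<comment> \<open>For fixed \<open>i\<close>, \<open>j\<close> the summand is a product over the
      three tensor indices, so Parseval applies to each index separately and gives a cube.\<close>
    have "?sum (\<lambda>b c d. (T b c d)\<^sup>2) = ?sum (\<lambda>b c d. \<Sum>i\<in>I. \<Sum>j\<in>I.
       ((w i \<bullet> b) * (w j \<bullet> b)) * (((w i \<bullet> c) * (w j \<bullet> c)) * ((w i \<bullet> d) * (w j \<bullet> d))))"
      by (simp add: T_def power2_eq_square sum_product mult_ac)
    also have "\<dots> = (\<Sum>i\<in>I. \<Sum>j\<in>I. ?sum (\<lambda>b c d.
       ((w i \<bullet> b) * (w j \<bullet> b)) * (((w i \<bullet> c) * (w j \<bullet> c)) * ((w i \<bullet> d) * (w j \<bullet> d)))))"
      by (simp only: sum.swap[of _ I B])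
    also have "\<dots> = (\<Sum>i\<in>I. \<Sum>j\<in>I. (w i \<bullet> w j) ^ 3)"
      by (simp add: sum_distrib_left[symmetric] sum_distrib_right[symmetric] parseval wW
          power3_eq_cube) (simp add: mult.assoc)
    finally show ?thesis .
  qed
  have T_trace: "(\<Sum>c\<in>B. T b c c) = r * (v \<bullet> b)" for b
  proof -
    have "(\<Sum>c\<in>B. T b c c) = (\<Sum>i\<in>I. (w i \<bullet> b) * (\<Sum>c\<in>B. (w i \<bullet> c) * (w i \<bullet> c)))"
      unfolding T_def by (subst sum.swap) (simp add: sum_distrib_left mult_ac)
    also have "\<dots> = r * (v \<bullet> b)"
      by (simp add: parseval wW norm_w v_def inner_sum_left sum_distrib_left mult.commute)
    finally show ?thesis .
  qed
  have D_trace: "(\<Sum>c\<in>B. D b c c) = m * (v \<bullet> b)" if "b \<in> B" for b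
  proof -
    \<comment> \<open>Each of the other two terms of \<open>D\<close> contributes
      \<open>v \<bullet> b\<close> once; this is the 2 in \<open>m\<close>.\<close>
    have "(\<Sum>c\<in>B. (v \<bullet> c) * of_bool (b = c)) = v \<bullet> b"
      using fin that by (simp add: of_bool_def if_distrib cong: if_cong)
    moreover have "(\<Sum>c\<in>B. D b c c) = (\<Sum>c\<in>B. (v \<bullet> b) + 2 * ((v \<bullet> c) * of_bool (b = c)))"
      by (intro sum.cong refl) (simp add: D_def)
    ultimately show ?thesis
      using B(5) by (simp add: m_def sum.distrib sum_distrib_left[symmetric]) (simp add: algebra_simps)
  qed
  have TD: "?sum (\<lambda>b c d. T b c d * D b c d) = 3 * r * (v \<bullet> v)"
  proof -
    have "?sum (\<lambda>b c d. T b c d * D b c d) = 3 * (\<Sum>b\<in>B. (v \<bullet> b) * (\<Sum>c\<in>B. T b c c))"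
      unfolding D_def using fin by (rule sum_symmetric_tensor) (simp_all add: T_def mult_ac)
    also have "\<dots> = 3 * r * (\<Sum>b\<in>B. (v \<bullet> b) * (v \<bullet> b))"
      by (simp add: T_trace sum_distrib_left mult_ac)
    finally show ?thesis by (simp add: parseval vW)
  qed
  have DD: "?sum (\<lambda>b c d. (D b c d)\<^sup>2) = 3 * m * (v \<bullet> v)"
  proof -
    have "?sum (\<lambda>b c d. D b c d * D b c d) = 3 * (\<Sum>b\<in>B. (v \<bullet> b) * (\<Sum>c\<in>B. D b c c))"
      by (subst (2) D_def, rule sum_symmetric_tensor) (auto simp: D_def fin)
    also have "\<dots> = 3 * m * (\<Sum>b\<in>B. (v \<bullet> b) * (v \<bullet> b))"
      by (simp add: D_trace sum_distrib_left mult_ac)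
    finally show ?thesis by (simp add: parseval vW power2_eq_square)
  qed
  \<comment> \<open>The traces of \<open>T\<close> and \<open>D\<close> are \<open>r\<close> and
    \<open>m\<close> times \<open>v\<close>, so this combination is traceless: it is
    \<open>m\<close> times the harmonic part of \<open>T\<close>.\<close>
  have "0 \<le> ?sum (\<lambda>b c d. (m * T b c d - r * D b c d)\<^sup>2)"
    by (intro sum_nonneg) simp
  also have "\<dots> = ?sum (\<lambda>b c d. m\<^sup>2 * (T b c d)\<^sup>2 - 2 * m * r * (T b c d * D b c d) + r\<^sup>2 * (D b c d)\<^sup>2)"
    by (simp add: power2_diff power_mult_distrib mult_ac) (simp add: algebra_simps)
  also have "\<dots> = m\<^sup>2 * ?sum (\<lambda>b c d. (T b c d)\<^sup>2) - 2 * m * r * ?sum (\<lambda>b c d. T b c d * D b c d)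
      + r\<^sup>2 * ?sum (\<lambda>b c d. (D b c d)\<^sup>2)"
    by (simp only: sum.distrib sum_subtractf sum_distrib_left)
  also have "\<dots> = m * (m * (\<Sum>i\<in>I. \<Sum>j\<in>I. (w i \<bullet> w j) ^ 3) - 3 * r\<^sup>2 * (v \<bullet> v))"
    unfolding TT TD DD by (simp add: power2_eq_square algebra_simps)
  finally show ?thesis
    using m by (simp add: zero_le_mult_iff m_def)
qed

text \<open>The trace of the frame operator is the sum of the squared norms of the points, and also
  \<open>c\<close> times the dimension, since the operator acts as \<open>c\<close> on the whole
  span by linearity.\<close>

lemma dim_span_tight_frame:
  fixes X :: "'a::euclidean_space set"
  assumes "\<And>z. z \<in> X \<Longrightarrow> (\<Sum>y\<in>X. (z \<bullet> y) *\<^sub>R y) = c *\<^sub>R z"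
    and norm1: "\<And>y. y \<in> X \<Longrightarrow> y \<bullet> y = 1"
  shows "c * real (dim (span X)) = real (card X)"
proof -
  obtain B where B: "B \<subseteq> span X" "pairwise orthogonal B" "\<And>b. b \<in> B \<Longrightarrow> norm b = 1"
    "card B = dim (span X)" "span B = span X"
    using orthonormal_basis_subspace[OF subspace_span, of X] by metis
  have frame: "(\<Sum>y\<in>X. (u \<bullet> y) *\<^sub>R y) = c *\<^sub>R u" if "u \<in> span X" for u
    using that
  proof (induction rule: span_induct)
    case base
    show ?case
      by (auto simp: subspace_def inner_add_left scaleR_add_left sum.distrib scaleR_add_right
          scaleR_scaleR[symmetric] scaleR_sum_right[symmetric] mult.commute[of c]
          simp del: scaleR_scaleR) (simp add: mult.commute)
  qed (use assms in auto)
  have "real (card X) = (\<Sum>y\<in>X. y \<bullet> y)" by (simp add: norm1)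
  also have "\<dots> = (\<Sum>y\<in>X. \<Sum>b\<in>B. (y \<bullet> b) * (y \<bullet> b))"
    using B(5) by (intro sum.cong refl parseval_orthonormal[OF B(2,3), symmetric]) (auto intro: span_base)
  also have "\<dots> = (\<Sum>b\<in>B. (\<Sum>y\<in>X. (b \<bullet> y) *\<^sub>R y) \<bullet> b)"
    by (subst sum.swap) (simp add: inner_sum_left inner_sum_right inner_commute)
  also have "\<dots> = (\<Sum>b\<in>B. c)"
    using B(1,3) by (intro sum.cong refl) (auto simp: frame dot_square_norm)
  finally show ?thesis using B(4) by simp
qed

lemma equiangular_frame_eigenvector:
  fixes X :: "(real ^ 'n) set"
  assumes "3 \<le> a" and n: "CARD('n) \<le> 3 * a\<^sup>2 - 16"
    and X: "equiangular_set (1 / real a) X"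
    and card: "2 * real (card X) = (real a ^ 2 - 2) * (real a ^ 2 - 1)"
    and z: "z \<in> X"
  shows "(\<Sum>y\<in>X. (z \<bullet> y) *\<^sub>R y) = (1 + (real (card X) - 1) / (real a)\<^sup>2) *\<^sub>R z"
proof -
  define A where "A = real a"
  have A: "A \<ge> 3" using assms(1) by (simp add: A_def)
  have fin: "finite X" and unit: "\<And>y. y \<in> X \<Longrightarrow> y \<bullet> y = 1"
    using X by (auto simp: equiangular_set_def dot_square_norm)
  define e where "e x y = A * (x \<bullet> y)" for x y :: "real ^ 'n"
  have e: "e x y = 1 \<or> e x y = -1" if "x \<in> X" "y \<in> X" "x \<noteq> y" for x y
  proof -
    have "x \<bullet> y = 1 / A \<or> x \<bullet> y = - (1 / A)"
      using X that by (auto simp: equiangular_set_def A_def)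
    then show ?thesis using A by (auto simp: e_def)
  qed
  define Y where "Y = X - {z}"
  have cardY: "real (card Y) = real (card X) - 1"
    using card.remove[OF fin z] by (simp add: Y_def)
  \<comment> \<open>As \<open>e z y\<close> squares to 1, the vector
    \<open>(A * e z y) *\<^sub>R y\<close> has scalar product 1 with \<open>z\<close>; subtracting
    \<open>z\<close> projects it onto the hyperplane orthogonal to \<open>z\<close>.\<close>
  define w where "w y = (A * e z y) *\<^sub>R y - z" for y
  define v where "v = (\<Sum>y\<in>Y. w y)"
  have inner_w: "w x \<bullet> w y = (if x = y then A\<^sup>2 - 1 else A * (e z x * e z y * e x y) - 1)"
    if "x \<in> Y" "y \<in> Y" for x y
  proof -
    have sq: "e z x * e z x = 1" "e z y * e z y = 1"
      using e[of z x] e[of z y] that z by (auto simp: Y_def)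
    have "w x \<bullet> w y = A * (e z x * e z y * (A * (x \<bullet> y))) - e z x * (A * (z \<bullet> x))
        - e z y * (A * (z \<bullet> y)) + z \<bullet> z"
      by (simp add: w_def inner_diff_left inner_diff_right inner_commute algebra_simps)
    also have "\<dots> = A * (e z x * e z y * (A * (x \<bullet> y))) - 1"
      using sq unit[OF z] by (simp add: e_def[symmetric])
    also have "\<dots> = (if x = y then A\<^sup>2 - 1 else A * (e z x * e z y * e x y) - 1)"
      using sq unit[of y] that by (cases "x = y") (auto simp: Y_def e_def[symmetric] power2_eq_square)
    finally show ?thesis .
  qed
  have orth: "w y \<in> {x. z \<bullet> x = 0}" if "y \<in> Y" for y
  proof -
    have "e z y * e z y = 1" using e[of z y] that z by (auto simp: Y_def)
    moreover have "z \<bullet> w y = e z y * e z y - 1"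
      using unit[OF z] by (simp add: w_def inner_diff_right e_def)
    ultimately show ?thesis by simp
  qed
  \<comment> \<open>The cubes of \<open>A - 1\<close> and \<open>- A - 1\<close> differ by
    \<open>2 * A * (A\<^sup>2 + 3)\<close>, which determines the linear coefficient.\<close>
  let ?h = "\<lambda>t. t ^ 3 - (A\<^sup>2 + 3) * t :: real"
  have h: "?h (w x \<bullet> w y) = - 2 * (A\<^sup>2 - 1) + of_bool (x = y) * (A\<^sup>2 - 1) * (A ^ 4 - 3 * A\<^sup>2)"
    if "x \<in> Y" "y \<in> Y" for x y
  proof (cases "x = y")
    case True
    have "(A\<^sup>2 - 1) ^ 3 - (A\<^sup>2 + 3) * (A\<^sup>2 - 1)
        = - 2 * (A\<^sup>2 - 1) + 1 * (A\<^sup>2 - 1) * (A ^ 4 - 3 * A\<^sup>2)"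
      by algebra
    then show ?thesis using True that by (simp add: inner_w)
  next
    case False
    then have "e z x * e z y * e x y = 1 \<or> e z x * e z y * e x y = -1"
      using e[of z x] e[of z y] e[of x y] that z by (auto simp: Y_def)
    moreover have "(A - 1) ^ 3 - (A\<^sup>2 + 3) * (A - 1) = - 2 * (A\<^sup>2 - 1)"
      and "(- A - 1) ^ 3 - (A\<^sup>2 + 3) * (- A - 1) = - 2 * (A\<^sup>2 - 1)"
      by algebra+
    ultimately show ?thesis
      using False that by (auto simp: inner_w)
  qed
  have "(\<Sum>x\<in>Y. \<Sum>y\<in>Y. ?h (w x \<bullet> w y))
      = (\<Sum>x\<in>Y. \<Sum>y\<in>Y. - 2 * (A\<^sup>2 - 1) + of_bool (x = y) * (A\<^sup>2 - 1) * (A ^ 4 - 3 * A\<^sup>2))"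
    by (intro sum.cong refl h)
  also have "\<dots> = (\<Sum>x\<in>Y. - 2 * (A\<^sup>2 - 1) * real (card Y) + (A\<^sup>2 - 1) * (A ^ 4 - 3 * A\<^sup>2))"
  proof (intro sum.cong refl)
    fix x assume "x \<in> Y"
    then have "(\<Sum>y\<in>Y. of_bool (x = y) :: real) = 1"
      using fin by (simp add: Y_def of_bool_def)
    then show "(\<Sum>y\<in>Y. - 2 * (A\<^sup>2 - 1) + of_bool (x = y) * (A\<^sup>2 - 1) * (A ^ 4 - 3 * A\<^sup>2))
        = - 2 * (A\<^sup>2 - 1) * real (card Y) + (A\<^sup>2 - 1) * (A ^ 4 - 3 * A\<^sup>2)"
      by (simp only: sum.distrib sum_distrib_right[symmetric] sum_constant) (simp add: algebra_simps)
  qed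
  also have "\<dots> = (A\<^sup>2 - 1) * real (card Y) * (A ^ 4 - 3 * A\<^sup>2 - 2 * real (card Y))"
    by (simp only: sum_constant) algebra
  \<comment> \<open>The exact cardinality enters here: the diagonal excess cancels the negative
    constant contributed by all pairs.\<close>
  also have "A ^ 4 - 3 * A\<^sup>2 - 2 * real (card Y) = 0"
    using card unfolding cardY A_def[symmetric] by (simp add: power2_eq_square power4_eq_xxxx algebra_simps)
  finally have "(\<Sum>x\<in>Y. \<Sum>y\<in>Y. ?h (w x \<bullet> w y)) = 0" by simp
  moreover have "v \<bullet> v = (\<Sum>x\<in>Y. \<Sum>y\<in>Y. w x \<bullet> w y)"
    unfolding v_def inner_sum_left by (simp only: inner_sum_right)
  ultimately have cubes: "(\<Sum>x\<in>Y. \<Sum>y\<in>Y. (w x \<bullet> w y) ^ 3) = (A\<^sup>2 + 3) * (v \<bullet> v)"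
    by (simp add: sum_subtractf sum_distrib_left)
  have "z \<noteq> 0" using unit[OF z] by auto
  then have "dim {x. z \<bullet> x = 0} = CARD('n) - 1"
    by (simp add: dim_hyperplane)
  \<comment> \<open>This keeps the natural subtraction \<open>3 * a\<^sup>2 - 16\<close> from
    truncating.\<close>
  moreover have "9 \<le> a\<^sup>2" using power_mono[OF assms(1), of 2] by simp
  then have "real (CARD('n) - 1) + 2 \<le> 3 * A\<^sup>2 - 15"
  proof -
    assume "9 \<le> a\<^sup>2"
    then have "CARD('n) - 1 + 2 + 15 \<le> 3 * a\<^sup>2" using n zero_less_card_finite[where 'a='n] by linarith
    then have "real (CARD('n) - 1 + 2 + 15) \<le> real (3 * a\<^sup>2)" by (rule of_nat_mono)
    then show ?thesis by (simp add: A_def)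
  qed
  ultimately have dim: "real (dim {x. z \<bullet> x = 0}) + 2 \<le> 3 * A\<^sup>2 - 15" by simp
  have "3 * (A\<^sup>2 - 1)\<^sup>2 * (v \<bullet> v)
      \<le> (real (dim {x. z \<bullet> x = 0}) + 2) * (\<Sum>x\<in>Y. \<Sum>y\<in>Y. (w x \<bullet> w y) ^ 3)"
    unfolding v_def using orth by (intro sum_inner_cubed_ge subspace_hyperplane) (auto simp: inner_w)
  also have "\<dots> \<le> (3 * A\<^sup>2 - 15) * ((A\<^sup>2 + 3) * (v \<bullet> v))"
    unfolding cubes using dim by (intro mult_right_mono) simp_all
  \<comment> \<open>The bound on the dimension leaves a deficit of 48 times
    \<open>v \<bullet> v\<close> against the lower bound, which forces \<open>v = 0\<close>.\<close>
  also have "\<dots> = 3 * (A\<^sup>2 - 1)\<^sup>2 * (v \<bullet> v) - 48 * (v \<bullet> v)"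
    by algebra
  finally have "v \<bullet> v \<le> 0" by simp
  then have "v = 0" using inner_gt_zero_iff[of v] by linarith
  moreover have "v = A\<^sup>2 *\<^sub>R (\<Sum>y\<in>Y. (z \<bullet> y) *\<^sub>R y) - real (card Y) *\<^sub>R z"
    by (simp add: v_def w_def e_def sum_subtractf scaleR_sum_right power2_eq_square mult.assoc sum_constant_scaleR
        del: sum_constant)
  ultimately have "A\<^sup>2 *\<^sub>R (\<Sum>y\<in>Y. (z \<bullet> y) *\<^sub>R y) = real (card Y) *\<^sub>R z" by simp
  then have "(1 / A\<^sup>2) *\<^sub>R (A\<^sup>2 *\<^sub>R (\<Sum>y\<in>Y. (z \<bullet> y) *\<^sub>R y)) = (1 / A\<^sup>2) *\<^sub>R (real (card Y) *\<^sub>R z)" by simp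
  then have "(\<Sum>y\<in>Y. (z \<bullet> y) *\<^sub>R y) = (real (card Y) / A\<^sup>2) *\<^sub>R z"
    using A by simp
  moreover have "(\<Sum>y\<in>X. (z \<bullet> y) *\<^sub>R y) = z + (\<Sum>y\<in>Y. (z \<bullet> y) *\<^sub>R y)"
    unfolding Y_def using unit[OF z] by (simp add: sum.remove[OF fin z])
  ultimately show ?thesis
    by (simp add: cardY A_def scaleR_add_left)
qed

theorem theorem4:
  fixes a :: nat and X :: "(real ^ 'n) set"
  assumes "3 \<le> a" and "odd a"
    and "CARD('n) \<le> 3 * a^2 - 16"
    and "equiangular_set (1 / real a) X"
    and "card X = (a^2 - 2) * (a^2 - 1) div 2"
  shows "\<exists>V :: (real ^ 'n) set. subspace V \<and> dim V = a^2 - 2 \<and> X \<subseteq> V"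
proof (intro exI conjI)
  define q where "q = (real a)\<^sup>2"
  have a2: "9 \<le> a\<^sup>2" using power_mono[OF assms(1), of 2] by simp
  then have q: "9 \<le> q" unfolding q_def by (metis of_nat_le_iff of_nat_numeral of_nat_power)
  obtain k where k: "a\<^sup>2 = k + 2" using that[of "a\<^sup>2 - 2"] a2 by simp
  have qk: "q = real k + 2" unfolding q_def using k by (metis of_nat_add of_nat_numeral of_nat_power)
  \<comment> \<open>A product of consecutive numbers is even, so \<open>div 2\<close> in the
    cardinality is exact.\<close>
  have "even ((a\<^sup>2 - 2) * (a\<^sup>2 - 1))" by (simp add: k)
  then have "2 * card X = k * (k + 1)" using assms(5) by (simp add: k)
  then have "real (2 * card X) = real (k * (k + 1))" by simp
  then have card: "2 * real (card X) = (q - 2) * (q - 1)" by (simp add: qk algebra_simps)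
  define c where "c = 1 + (real (card X) - 1) / q"
  \<comment> \<open>With this eigenvalue the cardinality equals \<open>c * (q - 2)\<close>, so the
    trace identity yields dimension \<open>q - 2\<close>.\<close>
  have c: "2 * c = q - 1"
  proof -
    have "2 * real (card X) - 2 = q * (q - 3)" using card by (simp add: algebra_simps)
    then have "(2 * real (card X) - 2) / q = q - 3" using q by simp
    then show ?thesis by (simp add: c_def field_simps)
  qed
  have "c * real (dim (span X)) = real (card X)"
  proof (rule dim_span_tight_frame)
    show "(\<Sum>y\<in>X. (z \<bullet> y) *\<^sub>R y) = c *\<^sub>R z" if "z \<in> X" for z
      unfolding c_def q_def
      using assms card that by (intro equiangular_frame_eigenvector) (simp_all add: q_def)
    show "y \<bullet> y = 1" if "y \<in> X" for y
      using assms(4) that by (auto simp: equiangular_set_def dot_square_norm)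
  qed
  then have "(q - 1) * real (dim (span X)) = (q - 1) * (q - 2)"
    using c card by (simp add: mult.commute flip: c)
  then have "real (dim (span X)) = real k" using q qk by simp
  then show "dim (span X) = a\<^sup>2 - 2" by (simp add: k)
qed (auto intro: span_base)

end
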